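(* Let $K\ge 2$, let $s\ge K$ be a prime, let $n,m$ be non-negative integers, and let $p\ge 0$ with $2p\in\mathbb Z$. For the $K$-user symmetric linear deterministic interference channel over $\mathsf F_s$ with direct gain $n$, cross gain $m$, and a feedback link of capacity $p\log s$ bits per channel use from each receiver to its corresponding transmitter, the symmetric rate $R_{sym}$ given by $$\frac{R_{sym}}{\log s}=\begin{cases}\min\{n-m+p,\; n-\frac m2\}, & 0\le m\le \frac n2,\\ \min\{m+p,\; n-\frac m2\}, & \frac n2\le m\le \frac{2n}{3},\\ n-\frac m2, & \frac{2n}{3}\le m<n,\\ \frac nK, & m=n,\\ \frac m2, & n<m\le 2n,\\ \min\{n+p,\; \frac m2\}, & 2n\le m,\end{cases}$$ is achievable.
   Context: Linear deterministic model: $\mathsf F_s$ is the field of integers modulo the prime $s$, and $q=\max(m,n)$. There are $K$ transmitters and $K$ receivers. At time $i$ transmitter $k$ sends a column vector $X_{k,i}=(X_{k,i}^1,\dots,X_{k,i}^q)\in\mathsf F_s^q$ ($X^1$ is the most significant level, $X^q$ the least significant). Receiver $k$ observes $Y_{k,i}=D^{q-n}X_{k,i}+\sum_{j\ne k}D^{q-m}X_{j,i}$ (arithmetic modulo $s$), where $D$ is the $q\times q$ down-shift matrix: $(Dx)_1=0$ and $(Dx)_l=x_{l-1}$ for $l\ge 2$. Each receiver $k$ has an error-free feedback link to transmitter $k$ only. Feedback is causal: the feedback symbol available to transmitter $k$ when it forms $X_{k,i}$ depends only on $Y_{k,1},\dots,Y_{k,i-1}$, and $X_{k,i}$ is a function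 of the message of transmitter $k$ and of the feedback symbols it has received so far. The feedback link has capacity $p\log s$ bits per channel use: over a block of length $T$, the sum of the logarithms of the feedback alphabet sizes used on each link is at most $Tp\log s$. Transmitter $k$ has a message $W_k$ intended for receiver $k$. A symmetric rate $R$ is achievable if for every $\epsilon>0$ there is a block length $T$ and a scheme in which each message set has at least $2^{T(R-\epsilon)}$ elements and every receiver $k$ recovers $W_k$ from $Y_{k,1},\dots,Y_{k,T}$ with zero error, for all message tuples. $\log$ is to base 2. *)

theory Defs
  imports Complex_Main "HOL-Computational_Algebra.Primes"
begin

text \<open>
  Elements of the prime field are represented by their residues \<open>0, \<dots>, s - 1\<close>, and a column
  vector of length \<open>q\<close> by a function on the levels \<open>1, \<dots>, q\<close> (level 1 is the most significant
  one) that vanishes at every other index.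
  Users are numbered \<open>0, \<dots>, K - 1\<close>; channel uses are numbered from 1.
\<close>

type_synonym signal = "nat \<Rightarrow> int"

definition signals :: "nat \<Rightarrow> nat \<Rightarrow> signal set" where
  "signals s q = {x. (\<forall>l\<in>{1..q}. x l \<in> {0..<int s}) \<and> (\<forall>l. l \<notin> {1..q} \<longrightarrow> x l = 0)}"

definition down_shift :: "nat \<Rightarrow> signal \<Rightarrow> signal" where
  "down_shift q x = (\<lambda>l. if 2 \<le> l \<and> l \<le> q then x (l - 1) else 0)"

definition channel_output ::
  "nat \<Rightarrow> nat \<Rightarrow> nat \<Rightarrow> nat \<Rightarrow> (nat \<Rightarrow> signal) \<Rightarrow> nat \<Rightarrow> signal" where
  "channel_output K s n m X k =
     (let q = max m n in
      (\<lambda>l. ((down_shift q ^^ (q - n)) (X k) l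
            + (\<Sum>j\<in>{..<K} - {k}. (down_shift q ^^ (q - m)) (X j) l)) mod int s))"

text \<open>
  An encoder maps a message and the list of feedback symbols received so far to the next channel
  input; a feedback map sends the list of outputs received so far to the next feedback symbol.
  The current time is determined by the length of the list.
\<close>

type_synonym encoder = "nat \<Rightarrow> nat list \<Rightarrow> signal"
type_synonym feedback = "signal list \<Rightarrow> nat"
type_synonym decoder = "signal list \<Rightarrow> nat"

definition feedback_symbols :: "feedback \<Rightarrow> signal list \<Rightarrow> nat list" where
  "feedback_symbols \<phi> ys = map (\<lambda>i. \<phi> (take i ys)) [1..<Suc (length ys)]"

text \<open>\<open>received K s n m enc fb W i k\<close> is the list of the first \<open>i\<close> outputs at receiver \<open>k\<close>.\<close>

primrec received ::
  "nat \<Rightarrow> nat \<Rightarrow> nat \<Rightarrow> nat \<Rightarrow> (nat \<Rightarrow> encoder) \<Rightarrow> (nat \<Rightarrow> feedback) \<Rightarrow> (nat \<Rightarrow> nat)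
    \<Rightarrow> nat \<Rightarrow> nat \<Rightarrow> signal list" where
  "received K s n m enc fb W 0 = (\<lambda>k. [])"
| "received K s n m enc fb W (Suc i) =
     (let Y = received K s n m enc fb W i;
          X = (\<lambda>j. enc j (W j) (feedback_symbols (fb j) (Y j)))
      in (\<lambda>k. Y k @ [channel_output K s n m X k]))"

text \<open>
  In a scheme of block length \<open>T\<close>, the messages of user \<open>k\<close> are \<open>0, \<dots>, M k - 1\<close>, and the feedback
  symbol produced at time \<open>i\<close> ranges over an alphabet of size \<open>A k i\<close>.
\<close>

definition zero_error_scheme ::
  "nat \<Rightarrow> nat \<Rightarrow> nat \<Rightarrow> nat \<Rightarrow> real \<Rightarrow> nat \<Rightarrow> (nat \<Rightarrow> nat) \<Rightarrow> (nat \<Rightarrow> nat \<Rightarrow> nat)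
    \<Rightarrow> (nat \<Rightarrow> encoder) \<Rightarrow> (nat \<Rightarrow> feedback) \<Rightarrow> (nat \<Rightarrow> decoder) \<Rightarrow> bool" where
  "zero_error_scheme K s n m p T M A enc fb dec \<longleftrightarrow>
     (\<forall>k<K. \<forall>w<M k. \<forall>fs. length fs < T \<longrightarrow> enc k w fs \<in> signals s (max m n)) \<and>
     (\<forall>k<K. \<forall>ys. length ys \<in> {1..T} \<and> set ys \<subseteq> signals s (max m n)
        \<longrightarrow> fb k ys < A k (length ys)) \<and>
     (\<forall>k<K. (\<Sum>i=1..T. log 2 (real (A k i))) \<le> real T * p * log 2 (real s)) \<and>
     (\<forall>W. (\<forall>k<K. W k < M k)
        \<longrightarrow> (\<forall>k<K. dec k (received K s n m enc fb W T k) = W k))"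

text \<open>A block length is positive: with \<open>T = 0\<close> every rate would be achievable.\<close>

definition achievable_sym_rate ::
  "nat \<Rightarrow> nat \<Rightarrow> nat \<Rightarrow> nat \<Rightarrow> real \<Rightarrow> real \<Rightarrow> bool" where
  "achievable_sym_rate K s n m p R \<longleftrightarrow>
     (\<forall>\<epsilon>>0. \<exists>T\<ge>1. \<exists>M A enc fb dec.
        zero_error_scheme K s n m p T M A enc fb dec \<and>
        (\<forall>k<K. real (M k) \<ge> 2 powr (real T * (R - \<epsilon>))))"

text \<open>The symmetric rate, in units of \<open>log 2 s\<close>.\<close>

definition normalized_sym_rate :: "nat \<Rightarrow> nat \<Rightarrow> nat \<Rightarrow> real \<Rightarrow> real" where
  "normalized_sym_rate K n m p =
     (if real m \<le> real n / 2 then min (real n - real m + p) (real n - real m / 2)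
      else if real m \<le> 2 * real n / 3 then min (real m + p) (real n - real m / 2)
      else if m < n then real n - real m / 2
      else if m = n then real n / real K
      else if m \<le> 2 * n then real m / 2
      else min (real n + p) (real m / 2))"

text \<open>The ranges of \<open>m\<close> overlap at their end points, where the expressions agree.\<close>

lemma normalized_sym_rate_cases:
  assumes "p \<ge> 0"
  shows "real m \<le> real n / 2 \<Longrightarrow>
           normalized_sym_rate K n m p = min (real n - real m + p) (real n - real m / 2)"
    and "real n / 2 \<le> real m \<Longrightarrow> real m \<le> 2 * real n / 3 \<Longrightarrow>
           normalized_sym_rate K n m p = min (real m + p) (real n - real m / 2)"
    and "2 * real n / 3 \<le> real m \<Longrightarrow> m < n \<Longrightarrow>
           normalized_sym_rate K n m p = real n - real m / 2"
    and "m = n \<Longrightarrow> normalized_sym_rate K n m p = real n / real K"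
    and "n < m \<Longrightarrow> m \<le> 2 * n \<Longrightarrow> normalized_sym_rate K n m p = real m / 2"
    and "2 * n \<le> m \<Longrightarrow> normalized_sym_rate K n m p = min (real n + p) (real m / 2)"
  using assms unfolding normalized_sym_rate_def by (auto simp: min_def)

end

(*
  Every receiver sees its own transmitter's levels plus the sum of the other transmitters' levels,
  moved by d = |n - m| against each other, so the other users act like one virtual interferer.
  Schemes with two slots meet the rate exactly, except at m = n, where the users share time.
  Without feedback, levels at distance d are used alternately, with a repetition in the second slot
  in chains of odd length. With feedback, some of the levels wasted in this way carry a symbol x_k
  in the first slot and, in the second slot, the sum I_k of the x_j with j \<noteq> k. The
  sum of the I_j with j \<noteq> k is (K - 2) I_k + (K - 1) x_k. If m < n, receiver k gets x_k and I_k
  directly on these levels, hence it can cancel this interference in both slots; if m > 2 n, it gets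
  I_k and this sum, and solves for x_k because s does not divide K - 1.
*)

theory Submission
  imports Defs "HOL-Library.FuncSet"
begin

section \<open>Channel outputs level by level, and vectors of residues\<close>

text \<open>Truncated subtraction lets one formula serve: for \<open>l \<le> d\<close> the index is
  0, where a signal vanishes.\<close>

lemma down_shift_funpow:
  assumes "x \<in> signals s q"
  shows "(down_shift q ^^ d) x l = (if l \<le> q then x (l - d) else 0)"
proof (induction d arbitrary: l)
  case 0
  then show ?case using assms by (auto simp: signals_def)
next
  case (Suc d)
  have "(down_shift q ^^ Suc d) x l = (if 2 \<le> l \<and> l \<le> q then (down_shift q ^^ d) x (l - 1) else 0)"
    by (simp add: down_shift_def[of q "(down_shift q ^^ d) x"])
  moreover have "x 0 = 0" using assms by (auto simp: signals_def)
  ultimately show ?case by (auto simp: Suc not_le)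
qed

lemma channel_output_level:
  assumes "\<And>j. X j \<in> signals s (max m n)" "l \<le> max m n"
  shows "channel_output K s n m X k l =
    (X k (l - (max m n - n)) + (\<Sum>j\<in>{..<K} - {k}. X j (l - (max m n - m)))) mod int s"
  using assms by (simp add: channel_output_def Let_def down_shift_funpow[OF assms(1)])

lemma channel_output_residue:
  assumes "s > 0"
  shows "channel_output K s n m X k l \<in> {0..<int s}"
  using assms by (simp add: channel_output_def Let_def)

text \<open>Decodability is proved by comparing two message tuples with equal outputs at receiver
  \<open>k\<close>. Their differences satisfy linear congruences, so interference can be cancelled
  by divisibility alone.\<close>

lemma channel_output_eq_dvd:
  assumes "\<And>j. X j \<in> signals s (max m n)" "\<And>j. X' j \<in> signals s (max m n)"
    and "channel_output K s n m X k = channel_output K s n m X' k" "l \<le> max m n"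
  shows "int s dvd (X k (l - (max m n - n)) - X' k (l - (max m n - n)))
    + (\<Sum>j\<in>{..<K} - {k}. X j (l - (max m n - m)) - X' j (l - (max m n - m)))"
proof -
  have "channel_output K s n m X k l = channel_output K s n m X' k l" using assms(3) by simp
  then show ?thesis
    unfolding channel_output_level[OF assms(1,4)] channel_output_level[OF assms(2,4)]
    by (simp add: mod_eq_dvd_iff sum_subtractf algebra_simps)
qed

lemma residues_eqI:
  assumes "u \<in> I \<rightarrow>\<^sub>E {0..<int s}" "u' \<in> I \<rightarrow>\<^sub>E {0..<int s}"
    and "\<And>i. i \<in> I \<Longrightarrow> int s dvd u i - u' i"
  shows "u = u'"
proof (rule PiE_ext[OF assms(1,2)])
  fix i assume i: "i \<in> I"
  have "u i mod int s = u' i mod int s" using assms(3)[OF i] by (simp add: mod_eq_dvd_iff)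
  moreover have "u i \<in> {0..<int s}" "u' i \<in> {0..<int s}" using assms(1,2) i by blast+
  ultimately show "u i = u' i" by simp
qed

text \<open>Serves to number both the messages and the feedback symbols.\<close>

lemma ex_bij_residues:
  assumes "finite I"
  shows "\<exists>g. bij_betw g {..<s ^ card I} (I \<rightarrow>\<^sub>E {0..<int s})"
proof -
  have "card (I \<rightarrow>\<^sub>E {0..<int s}) = s ^ card I" using assms by (simp add: card_PiE)
  moreover have "finite (I \<rightarrow>\<^sub>E {0..<int s})" using assms by (simp add: finite_PiE)
  ultimately show ?thesis
    using ex_bij_betw_nat_finite[of "I \<rightarrow>\<^sub>E {0..<int s}"] by (simp add: atLeast0LessThan)
qed

section \<open>Achievability from a scheme that feeds back the first output only\<close>

text \<open>
  All schemes used here feed back only some levels \<open>E\<close> of the first output, so an input depends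
  on the slot \<open>t\<close> (counted from 0), the message \<open>u\<close> and the restriction of that output to \<open>E\<close>.
\<close>

lemma achievable_by_first_slot_feedback:
  fixes x :: "nat \<Rightarrow> nat \<Rightarrow> ('i \<Rightarrow> int) \<Rightarrow> signal \<Rightarrow> signal"
  assumes s: "s \<ge> 2" and fin: "finite I" "finite E" and T: "T \<ge> 1"
    and cap: "real (card E) \<le> real T * p"
    and input: "\<And>k t u v. u \<in> I \<rightarrow>\<^sub>E {0..<int s} \<Longrightarrow> x k t u v \<in> signals s (max m n)"
    and causal: "\<And>k u v v'. x k 0 u v = x k 0 u v'"
    and decodable: "\<And>u u' Y Y' k. k < K \<Longrightarrow>
      (\<And>j. u j \<in> I \<rightarrow>\<^sub>E {0..<int s}) \<Longrightarrow> (\<And>j. u' j \<in> I \<rightarrow>\<^sub>E {0..<int s}) \<Longrightarrow>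
      (\<And>t k. Y t k = channel_output K s n m (\<lambda>j. x j t (u j) (restrict (Y 0 j) E)) k) \<Longrightarrow>
      (\<And>t k. Y' t k = channel_output K s n m (\<lambda>j. x j t (u' j) (restrict (Y' 0 j) E)) k) \<Longrightarrow>
      (\<And>t. t < T \<Longrightarrow> Y t k = Y' t k) \<Longrightarrow> u k = u' k"
    and rate: "real T * R \<le> real (card I) * log 2 (real s)"
  shows "achievable_sym_rate K s n m p R"
proof -
  define N where "N = s ^ card I"
  have N: "N > 0" using s by (simp add: N_def)
  obtain g where g: "bij_betw g {..<N} (I \<rightarrow>\<^sub>E {0..<int s})"
    using ex_bij_residues[OF fin(1)] unfolding N_def by blast
  obtain h where h: "bij_betw h {..<s ^ card E} (E \<rightarrow>\<^sub>E {0..<int s})"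
    using ex_bij_residues[OF fin(2)] by blast
  \<comment> \<open>Reduction mod \<open>N\<close> makes \<open>msg\<close> valid for every number,
    so facts about inputs and outputs need no bound on \<open>W\<close>.\<close>
  define msg where "msg w = g (w mod N)" for w
  have msg: "msg w \<in> I \<rightarrow>\<^sub>E {0..<int s}" for w
    using g N unfolding msg_def bij_betw_def by (metis imageI lessThan_iff mod_less_divisor)
  define h' where "h' = the_inv_into {..<s ^ card E} h"
  have h'_less: "h' v < s ^ card E" and h_h': "h (h' v) = v" if "v \<in> E \<rightarrow>\<^sub>E {0..<int s}" for v
    using h that the_inv_into_into[of h "{..<s ^ card E}" v "{..<s ^ card E}"]
      f_the_inv_into_f_bij_betw[OF h, of v]
    by (auto simp: h'_def bij_betw_def)
  \<comment> \<open>For empty \<open>fs\<close> the entry \<open>fs ! 0\<close> is unspecified, but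
    the slot is then 0, where \<open>causal\<close> allows any last argument.\<close>
  define enc where "enc = (\<lambda>k w fs. x k (length fs) (msg w) (h (fs ! 0)))"
  \<comment> \<open>Symbols after the first come from an alphabet of size 1 and cost log 1 =
    0.\<close>
  define fb :: "nat \<Rightarrow> feedback"
    where "fb = (\<lambda>k ys. if length ys = 1 then h' (restrict (ys ! 0) E) else 0)"
  define A :: "nat \<Rightarrow> nat \<Rightarrow> nat" where "A = (\<lambda>k i. if i = 1 then s ^ card E else 1)"
  \<comment> \<open>A closed form of the outputs: slot 0 ignores fed back values, so its output can
    be computed with the dummy \<open>\<lambda>_. 0\<close>.\<close>
  define Y where "Y W t = (\<lambda>k. channel_output K s n m (\<lambda>j. x j t (msg (W j))
     (restrict (channel_output K s n m (\<lambda>j. x j 0 (msg (W j)) (\<lambda>_. 0)) j) E)) k)" for W t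
  have Y0: "Y W 0 k = channel_output K s n m (\<lambda>j. x j 0 (msg (W j)) (\<lambda>_. 0)) k" for W k
    unfolding Y_def using causal by (metis (no_types, lifting))
  have Y: "Y W t k = channel_output K s n m (\<lambda>j. x j t (msg (W j)) (restrict (Y W 0 j) E)) k"
    for W t k
    unfolding Y0 by (simp add: Y_def)
  have Y_res: "restrict (Y W 0 j) E \<in> E \<rightarrow>\<^sub>E {0..<int s}" for W j
    unfolding Y0 using s by (intro restrict_PiE_iff[THEN iffD2] ballI channel_output_residue) auto
  have received: "received K s n m enc fb W i = (\<lambda>k. map (\<lambda>t. Y W t k) [0..<i])" for W i
  proof (induction i)
    case (Suc i)
    have "enc j (W j) (feedback_symbols (fb j) (map (\<lambda>t. Y W t j) [0..<i]))
        = x j i (msg (W j)) (restrict (Y W 0 j) E)" for j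
    proof (cases i)
      case 0
      then show ?thesis by (auto simp: enc_def feedback_symbols_def intro: causal)
    next
      case (Suc i')
      have "feedback_symbols (fb j) (map (\<lambda>t. Y W t j) [0..<i]) ! 0 = h' (restrict (Y W 0 j) E)"
        by (simp add: feedback_symbols_def Suc upt_conv_Cons fb_def del: upt_Suc)
      moreover have "length (feedback_symbols (fb j) (map (\<lambda>t. Y W t j) [0..<i])) = i"
        by (simp add: feedback_symbols_def del: upt_Suc)
      ultimately show ?thesis by (simp add: enc_def h_h'[OF Y_res])
    qed
    then show ?case by (simp add: Let_def Suc Y[of W i])
  qed simp
  \<comment> \<open>Any message compatible with the received list will do, since
    \<open>decodable\<close> leaves only one.\<close>
  define dec :: "nat \<Rightarrow> decoder"
    where "dec = (\<lambda>k ys. SOME w. \<exists>W. (\<forall>k<K. W k < N) \<and> W k = w \<and> received K s n m enc fb W T k = ys)"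
  have dec: "dec k (received K s n m enc fb W T k) = W k"
    if W: "\<forall>k<K. W k < N" and k: "k < K" for W k
  proof -
    have "\<exists>W'. (\<forall>k<K. W' k < N) \<and> W' k = dec k (received K s n m enc fb W T k)
        \<and> received K s n m enc fb W' T k = received K s n m enc fb W T k"
      unfolding dec_def by (rule someI[of _ "W k"]) (use W in blast)
    then obtain W' where W': "\<forall>k<K. W' k < N" "W' k = dec k (received K s n m enc fb W T k)"
      and eq: "received K s n m enc fb W' T k = received K s n m enc fb W T k" by blast
    have "Y W' t k = Y W t k" if "t < T" for t
      using eq that by (simp add: received)
    then have "msg (W' k) = msg (W k)"
      by (intro decodable[OF k, of "\<lambda>j. msg (W' j)" "\<lambda>j. msg (W j)" "Y W'" "Y W"] msg Y)
    then have "W' k = W k"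
      using g W W'(1) k unfolding msg_def bij_betw_def by (auto dest: inj_onD)
    with W'(2) show ?thesis by simp
  qed
  have "zero_error_scheme K s n m p T (\<lambda>_. N) A enc fb dec"
    unfolding zero_error_scheme_def
  proof (intro conjI allI impI)
    fix k w fs show "enc k w fs \<in> signals s (max m n)" by (simp add: enc_def input msg)
  next
    fix k ys assume ys: "length ys \<in> {1..T} \<and> set ys \<subseteq> signals s (max m n)"
    show "fb k ys < A k (length ys)"
    proof (cases "length ys = 1")
      case True
      then have "ys ! 0 \<in> signals s (max m n)" using ys by (simp add: subset_iff)
      then have "restrict (ys ! 0) E \<in> E \<rightarrow>\<^sub>E {0..<int s}"
        using s by (intro restrict_PiE_iff[THEN iffD2] ballI) (fastforce simp: signals_def)
      then show ?thesis using True h'_less by (simp add: fb_def A_def)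
    qed (simp add: fb_def A_def)
  next
    fix k
    have "(\<Sum>i=1..T. log 2 (real (A k i))) = (\<Sum>i\<in>{1}. log 2 (real (A k i)))"
      using T by (intro sum.mono_neutral_right) (auto simp: A_def)
    also have "\<dots> = real (card E) * log 2 (real s)"
      using s by (simp add: A_def log_nat_power)
    also have "\<dots> \<le> real T * p * log 2 (real s)"
      using cap s by (intro mult_right_mono) auto
    finally show "(\<Sum>i=1..T. log 2 (real (A k i))) \<le> real T * p * log 2 (real s)" .
  qed (use dec in blast)
  moreover have "2 powr (real T * (R - \<epsilon>)) \<le> real N" if "\<epsilon> > 0" for \<epsilon>
  proof -
    have "real T * (R - \<epsilon>) \<le> real T * R" using that by (intro mult_left_mono) auto
    also have "\<dots> \<le> log 2 (real N)" using rate s by (simp add: N_def log_nat_power)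
    finally show ?thesis using N by (simp add: le_log_iff)
  qed
  ultimately show ?thesis
    unfolding achievable_sym_rate_def using T by blast
qed

section \<open>Alternating levels without feedback\<close>

text \<open>
  Split the levels into chains of step \<open>d\<close>. Without feedback, a chain alternates used and
  unused levels; one of odd length has to carry half a symbol more per slot, so in it a symbol on a
  level of \<open>G\<close> is sent in the first slot only and repeated one step further down in the second slot.
\<close>

lemma ex_alternating_levels:
  assumes "2 * d \<le> m" "d \<ge> 1"
  shows "\<exists>F G. F \<subseteq> {1..m} \<and> G \<subseteq> {1..m} \<and> F \<inter> G = {} \<and> (\<forall>l\<in>F \<union> G. l + d \<le> m \<and> l + d \<notin> F)
    \<and> (\<forall>l\<in>G. l + d \<notin> G) \<and> 2 * card F + card G = m"
  using assms
proof (induction m rule: less_induct)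
  case (less m)
  consider "m < 3 * d" | "3 * d \<le> m" "m < 4 * d" | "4 * d \<le> m" by linarith
  then show ?case
  proof cases
    \<comment> \<open>Chains have length 2 or 3: \<open>F\<close> takes all tops, \<open>G\<close>
      the middle levels of the chains of length 3.\<close>
    case 1
    then show ?thesis using less.prems
      by (intro exI[of _ "{1..d}"] exI[of _ "{d + 1..m - d}"]) auto
  next
    \<comment> \<open>Chains have length 3 or 4: \<open>F\<close> takes all tops and the third
      levels of the chains of length 4, \<open>G\<close> the middle levels of those of length
      3.\<close>
    case 2
    have "card ({1..d} \<union> {2 * d + 1..m - d}) = d + (m - 3 * d)"
      by (subst card_Un_disjoint) (auto simp: algebra_simps)
    then show ?thesis using less.prems 2
      by (intro exI[of _ "{1..d} \<union> {2 * d + 1..m - d}"] exI[of _ "{m - 2 * d + 1..2 * d}"]) auto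
  next
    case 3
    obtain F G where FG: "F \<subseteq> {1..m - 2 * d}" "G \<subseteq> {1..m - 2 * d}" "F \<inter> G = {}"
      "\<forall>l\<in>F \<union> G. l + d \<le> m - 2 * d \<and> l + d \<notin> F" "\<forall>l\<in>G. l + d \<notin> G"
      "2 * card F + card G = m - 2 * d"
    proof -
      have "m - 2 * d < m" "2 * d \<le> m - 2 * d" using less.prems 3 by simp_all
      from less.IH[OF this less.prems(2)] show ?thesis using that by blast
    qed
    let ?F = "F \<union> {m - 2 * d + 1..m - d}"
    have "finite F" using FG(1) finite_subset by blast
    then have "card ?F = card F + d"
      using FG(1) 3 by (subst card_Un_disjoint) auto
    then have "2 * card ?F + card G = m" using FG(6) 3 by linarith
    moreover have "?F \<subseteq> {1..m}" "G \<subseteq> {1..m}" using FG(1,2) 3 by (auto simp: subset_iff)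
    moreover have "?F \<inter> G = {}" using FG(2,3) by (auto simp: subset_iff)
    moreover have "\<forall>l\<in>?F \<union> G. l + d \<le> m \<and> l + d \<notin> ?F"
    proof
      fix l assume l: "l \<in> ?F \<union> G"
      show "l + d \<le> m \<and> l + d \<notin> ?F"
      proof (cases "l \<in> F \<union> G")
        case True
        then have "l + d \<le> m - 2 * d" "l + d \<notin> F" using FG(4) by auto
        then show ?thesis by simp
      next
        case False
        then have "m - 2 * d < l" "l \<le> m - d" using l by auto
        then show ?thesis using FG(1) 3 less.prems by (auto simp: subset_iff)
      qed
    qed
    ultimately show ?thesis
      using FG(5) by (intro exI[of _ ?F] exI[of _ G] conjI)
  qed
qed

text \<open>Symbols are indexed by slot and level; a repeated one keeps its index in slot 0. For a
  set \<open>G\<close> of positive levels, \<open>l - d \<in> G\<close> excludes truncation.\<close>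

definition aligned_input :: "nat set \<Rightarrow> nat set \<Rightarrow> nat \<Rightarrow> nat \<Rightarrow> (nat \<times> nat \<Rightarrow> int) \<Rightarrow> signal" where
  "aligned_input F G d t u = (\<lambda>l. if (t, l) \<in> {0, 1} \<times> F \<union> {0} \<times> G then u (t, l)
     else if t = 1 \<and> l - d \<in> G then u (0, l - d) else 0)"

lemma aligned_input_signals:
  assumes "u \<in> {0, 1} \<times> F \<union> {0} \<times> G \<rightarrow>\<^sub>E {0..<int s}" "s > 0"
    and "F \<subseteq> {1..q}" "G \<subseteq> {1..q}" "\<forall>l\<in>G. l + d \<le> q"
  shows "aligned_input F G d t u \<in> signals s q"
proof -
  have "u i \<in> {0..<int s}" if "i \<in> {0, 1} \<times> F \<union> {0} \<times> G" for i
    using assms(1) that by blast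
  then have "aligned_input F G d t u l \<in> {0..<int s}" for l
    unfolding aligned_input_def using assms(2) by auto
  moreover have "aligned_input F G d t u l = 0" if "l \<notin> {1..q}" for l
    using assms(3-5) that by (fastforce simp: aligned_input_def)
  ultimately show ?thesis by (simp add: signals_def)
qed

lemma card_two_slots:
  assumes "finite F" "finite G" "F \<inter> G = {}"
  shows "card ({0, 1::nat} \<times> F \<union> {0} \<times> G) = 2 * card F + card G"
  using assms by (subst card_Un_disjoint) (auto simp: card_cartesian_product)

text \<open>The own level \<open>l\<close> meets the interferers' level \<open>l - d\<close>.
  Symbols on \<open>F\<close> meet at most repeats, in the second slot; a symbol on \<open>G\<close>
  is read from its own repeat on \<open>l + d\<close>, since the interferers are silent on
  \<open>l\<close> in that slot.\<close>

lemma achievable_weak_alignment: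
  assumes s: "s \<ge> 2" and p: "p \<ge> 0" and n: "n = m + d"
    and FG: "F \<subseteq> {1..n}" "G \<subseteq> {1..n}" "F \<inter> G = {}"
    and F: "\<forall>l\<in>F \<union> G. l + d \<notin> F" and G: "\<forall>l\<in>G. l + d \<le> n \<and> l + d \<notin> G"
    and rate: "2 * R \<le> real (2 * card F + card G) * log 2 (real s)"
  shows "achievable_sym_rate K s n m p R"
proof -
  let ?I = "{0, 1 :: nat} \<times> F \<union> {0} \<times> G"
  have fin: "finite F" "finite G" using FG finite_subset by blast+
  have input: "aligned_input F G d t u \<in> signals s n" if "u \<in> ?I \<rightarrow>\<^sub>E {0..<int s}" for t u
    using that by (rule aligned_input_signals) (use s FG G in auto)
  have q: "max m n = n" using n by simp
  show ?thesis
  proof (rule achievable_by_first_slot_feedback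
      [of s ?I "{}" 2 _ "\<lambda>k t u v. aligned_input F G d t u"])
    fix k t u v assume "u \<in> ?I \<rightarrow>\<^sub>E {0..<int s}"
    then show "aligned_input F G d t u \<in> signals s (max m n)"
      unfolding q by (rule input)
  next
    fix u u' :: "nat \<Rightarrow> nat \<times> nat \<Rightarrow> int" and Y Y' :: "nat \<Rightarrow> nat \<Rightarrow> signal" and k
    assume u: "\<And>j. u j \<in> ?I \<rightarrow>\<^sub>E {0..<int s}" and u': "\<And>j. u' j \<in> ?I \<rightarrow>\<^sub>E {0..<int s}"
      and Y: "\<And>t k. Y t k = channel_output K s n m (\<lambda>j. aligned_input F G d t (u j)) k"
      and Y': "\<And>t k. Y' t k = channel_output K s n m (\<lambda>j. aligned_input F G d t (u' j)) k"
      and eq: "\<And>t. t < 2 \<Longrightarrow> Y t k = Y' t k"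
    define D where "D t j l = aligned_input F G d t (u j) l - aligned_input F G d t (u' j) l"
      for t j l
    define V where "V t l = (\<Sum>j\<in>{..<K} - {k}. D t j l)" for t l
    have obs: "int s dvd D t k l + V t (l - d)" if "t < 2" "l \<le> n" for t l
      using channel_output_eq_dvd[of "\<lambda>j. aligned_input F G d t (u j)" s m n
          "\<lambda>j. aligned_input F G d t (u' j)" K k l] input[OF u] input[OF u'] eq[OF that(1)] that(2) n
      unfolding Y Y' q D_def V_def by simp
    have D0: "D 0 j l = 0" if "l \<notin> F" "l \<notin> G" for j l
      using that by (simp add: D_def aligned_input_def)
    have D1: "D 1 j l = D 0 j (l - d)" if "l \<notin> F" "l - d \<in> G" for j l
      using that by (simp add: D_def aligned_input_def)
    have D10: "D 1 j l = 0" if "l \<notin> F" "l - d \<notin> G" for j l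
      using that by (simp add: D_def aligned_input_def)
    have pos: "l \<ge> 1" if "l \<in> F \<union> G" for l using FG that by auto
    have pred: "l - d \<notin> F \<union> G" if "l \<in> F" for l
    proof
      assume "l - d \<in> F \<union> G"
      moreover from this have "l - d + d = l" using pos[of "l - d"] by simp
      ultimately show False using F that by metis
    qed
    have "int s dvd D t k l" if tl: "(t, l) \<in> ?I" for t l
    proof -
      consider "t = 0" "l \<in> F" | "t = 1" "l \<in> F" | "t = 0" "l \<in> G" using tl by blast
      then show ?thesis
      proof cases
        case 1
        then have "V 0 (l - d) = 0" using pred by (simp add: V_def D0)
        then show ?thesis using obs[of 0 l] 1 FG by auto
      next
        case 2
        have "int s dvd V 1 (l - d)"
        proof (cases "l - d - d \<in> G")
          case True
          \<comment> \<open>The symbols repeated on \<open>l - d\<close> were sent on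
            \<open>l - d - d\<close> in slot 0, and their sum arrived then at output level
            \<open>l - d\<close>, where the own input was silent.\<close>
          have "V 1 (l - d) = V 0 (l - d - d)"
            unfolding V_def using pred[OF 2(2)] True by (intro sum.cong refl D1) auto
          moreover have "D 0 k (l - d) = 0" using pred[OF 2(2)] by (simp add: D0)
          moreover have "l - d \<le> n" using 2 FG(1) by (auto simp: subset_iff intro: diff_le_self le_trans)
          ultimately show ?thesis using obs[of 0 "l - d"] by simp
        next
          case False
          then have "V 1 (l - d) = 0"
            unfolding V_def using pred[OF 2(2)] by (intro sum.neutral ballI D10) auto
          then show ?thesis by simp
        qed
        moreover have "int s dvd D 1 k l + V 1 (l - d)" using obs[of 1 l] 2 FG by auto
        ultimately show ?thesis using 2 by (simp add: dvd_add_left_iff)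
      next
        case 3
        then have l: "l \<notin> F" "l - d \<notin> G" using FG G pos[of "l - d"] by fastforce+
        then have "V 1 l = 0" unfolding V_def by (intro sum.neutral ballI D10)
        moreover have "l + d \<le> n" "D 1 k (l + d) = D 0 k l" using F G 3 D1[of "l + d" k] by auto
        ultimately show ?thesis using obs[of 1 "l + d"] 3 by simp
      qed
    qed
    then show "u k = u' k"
      by (intro residues_eqI[OF u u']) (force simp: D_def aligned_input_def)
  qed (use s p fin rate FG(3) in \<open>auto simp: card_two_slots[unfolded One_nat_def]\<close>)
qed

text \<open>Now the own level \<open>l\<close> meets the interferers' level \<open>l + d\<close>.
  Symbols on \<open>G\<close> are read directly in the first slot; those on \<open>F\<close> may
  meet interfering symbols on \<open>G\<close> there, whose sum is learnt from the repeats.\<close>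

lemma achievable_strong_alignment:
  assumes s: "s \<ge> 2" and p: "p \<ge> 0" and m: "m = n + d"
    and FG: "F \<subseteq> {1..m}" "G \<subseteq> {1..m}" "F \<inter> G = {}"
    and F: "\<forall>l\<in>F \<union> G. l + d \<le> m \<and> l + d \<notin> F" and G: "\<forall>l\<in>G. l + d \<notin> G"
    and rate: "2 * R \<le> real (2 * card F + card G) * log 2 (real s)"
  shows "achievable_sym_rate K s n m p R"
proof -
  let ?I = "{0, 1 :: nat} \<times> F \<union> {0} \<times> G"
  have fin: "finite F" "finite G" using FG finite_subset by blast+
  have input: "aligned_input F G d t u \<in> signals s m" if "u \<in> ?I \<rightarrow>\<^sub>E {0..<int s}" for t u
    using that by (rule aligned_input_signals) (use s FG F in auto)
  have q: "max m n = m" using m by simp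
  show ?thesis
  proof (rule achievable_by_first_slot_feedback
      [of s ?I "{}" 2 _ "\<lambda>k t u v. aligned_input F G d t u"])
    fix k t u v assume "u \<in> ?I \<rightarrow>\<^sub>E {0..<int s}"
    then show "aligned_input F G d t u \<in> signals s (max m n)"
      unfolding q by (rule input)
  next
    fix u u' :: "nat \<Rightarrow> nat \<times> nat \<Rightarrow> int" and Y Y' :: "nat \<Rightarrow> nat \<Rightarrow> signal" and k
    assume u: "\<And>j. u j \<in> ?I \<rightarrow>\<^sub>E {0..<int s}" and u': "\<And>j. u' j \<in> ?I \<rightarrow>\<^sub>E {0..<int s}"
      and Y: "\<And>t k. Y t k = channel_output K s n m (\<lambda>j. aligned_input F G d t (u j)) k"
      and Y': "\<And>t k. Y' t k = channel_output K s n m (\<lambda>j. aligned_input F G d t (u' j)) k"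
      and eq: "\<And>t. t < 2 \<Longrightarrow> Y t k = Y' t k"
    define D where "D t j l = aligned_input F G d t (u j) l - aligned_input F G d t (u' j) l"
      for t j l
    define V where "V t l = (\<Sum>j\<in>{..<K} - {k}. D t j l)" for t l
    have obs: "int s dvd D t k l + V t (l + d)" if "t < 2" "l + d \<le> m" for t l
      using channel_output_eq_dvd[of "\<lambda>j. aligned_input F G d t (u j)" s m n
          "\<lambda>j. aligned_input F G d t (u' j)" K k "l + d"] input[OF u] input[OF u'] eq[OF that(1)] that(2) m
      unfolding Y Y' q D_def V_def by simp
    have D0: "D 0 j l = 0" if "l \<notin> F" "l \<notin> G" for j l
      using that by (simp add: D_def aligned_input_def)
    have D1: "D 1 j (l + d) = D 0 j l" if "l + d \<notin> F" "l \<in> G" for j l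
      using that by (simp add: D_def aligned_input_def)
    have D10: "D 1 j (l + d) = 0" if "l + d \<notin> F" "l \<notin> G" for j l
      using that by (simp add: D_def aligned_input_def)
    have "int s dvd D t k l" if tl: "(t, l) \<in> ?I" for t l
    proof -
      consider "t = 0" "l \<in> F" | "t = 1" "l \<in> F" | "t = 0" "l \<in> G" using tl by blast
      then show ?thesis
      proof cases
        case 1
        have "int s dvd V 0 (l + d)"
        proof (cases "l + d \<in> G")
          case True
          \<comment> \<open>In slot 1 the repeats arrive at output level \<open>l + d + d\<close>
            without any own symbol.\<close>
          then have "l + d + d \<le> m" "l + d + d \<notin> F" using F by auto
          moreover have "D 1 k (l + d) = 0" using F FG(3) 1 by (intro D10) auto
          moreover have "V 1 (l + d + d) = V 0 (l + d)"
            unfolding V_def using calculation(2) True by (intro sum.cong refl D1) auto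
          ultimately show ?thesis using obs[of 1 "l + d"] by simp
        next
          case False
          then show ?thesis using F 1 by (simp add: V_def D0)
        qed
        moreover have "int s dvd D 0 k l + V 0 (l + d)" using obs[of 0 l] F 1 by auto
        ultimately show ?thesis using 1 by (simp add: dvd_add_left_iff)
      next
        case 2
        then have "V 1 (l + d) = 0" unfolding V_def using F FG(3) by (intro sum.neutral ballI D10) auto
        then show ?thesis using obs[of 1 l] F 2 by auto
      next
        case 3
        then have "V 0 (l + d) = 0" using F G by (simp add: V_def D0)
        then show ?thesis using obs[of 0 l] F 3 by auto
      qed
    qed
    then show "u k = u' k"
      by (intro residues_eqI[OF u u']) (force simp: D_def aligned_input_def)
  qed (use s p fin rate FG(3) in \<open>auto simp: card_two_slots[unfolded One_nat_def]\<close>)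
qed

section \<open>Forwarding the sum of the interferers\<close>

text \<open>
  With feedback, levels of \<open>B\<close> carry a new symbol in each slot. A symbol on a level \<open>l \<in> E\<close> is sent
  in the first slot only, and in the second slot this level carries the sum of the other users'
  symbols sent on it, which is learnt by removing the own signal from level \<open>l + c\<close> of the
  fed back output.
\<close>

definition feedback_input ::
  "nat \<Rightarrow> nat set \<Rightarrow> nat set \<Rightarrow> nat \<Rightarrow> nat \<Rightarrow> (nat \<times> nat \<Rightarrow> int) \<Rightarrow> signal \<Rightarrow> signal" where
  "feedback_input s B E c t u v = (\<lambda>l. if (t, l) \<in> {0, 1} \<times> B \<union> {0} \<times> E then u (t, l)
     else if t = 1 \<and> l \<in> E then (v (l + c) - (if l + c \<in> B then u (0, l + c) else 0)) mod int s
     else 0)"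

lemma feedback_input_signals:
  assumes "u \<in> {0, 1} \<times> B \<union> {0} \<times> E \<rightarrow>\<^sub>E {0..<int s}" "s > 0" "B \<subseteq> {1..q}" "E \<subseteq> {1..q}"
  shows "feedback_input s B E c t u v \<in> signals s q"
proof -
  have "u i \<in> {0..<int s}" if "i \<in> {0, 1} \<times> B \<union> {0} \<times> E" for i
    using assms(1) that by blast
  then have "feedback_input s B E c t u v l \<in> {0..<int s}" for l
    unfolding feedback_input_def using assms(2) by auto
  moreover have "feedback_input s B E c t u v l = 0" if "l \<notin> {1..q}" for l
    using assms(3,4) that by (auto simp: feedback_input_def)
  ultimately show ?thesis by (simp add: signals_def)
qed

text \<open>Among the \<open>K - 1\<close> inner sums, \<open>a k\<close> occurs in all, and any
  other \<open>a i\<close> in all but the one with \<open>j = i\<close>.\<close>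

lemma sum_sums_of_others:
  fixes a :: "nat \<Rightarrow> int"
  assumes "k < K"
  shows "(\<Sum>j\<in>{..<K} - {k}. \<Sum>i\<in>{..<K} - {j}. a i)
    = (int K - 2) * (\<Sum>i\<in>{..<K} - {k}. a i) + (int K - 1) * a k"
proof -
  have others: "(\<Sum>i\<in>{..<K} - {j}. a i) = (\<Sum>i<K. a i) - a j" if "j < K" for j
    using that by (simp add: sum_diff1)
  have "(\<Sum>j\<in>{..<K} - {k}. \<Sum>i\<in>{..<K} - {j}. a i) = (\<Sum>j\<in>{..<K} - {k}. (\<Sum>i<K. a i) - a j)"
    by (intro sum.cong) (auto simp: others)
  also have "\<dots> = (int K - 1) * (\<Sum>i<K. a i) - (\<Sum>i\<in>{..<K} - {k}. a i)"
    using assms by (simp add: sum_subtractf of_nat_diff)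
  also have "(\<Sum>i<K. a i) = (\<Sum>i\<in>{..<K} - {k}. a i) + a k" using others[OF assms] by simp
  finally show ?thesis by (simp add: algebra_simps)
qed

text \<open>To be applied to differences of two message tuples, with \<open>f j\<close> forwarded by
  user \<open>j\<close>. For weak interference it removes the second interference, as
  \<open>a k\<close> is known; for strong interference it determines \<open>a k\<close>.\<close>

lemma dvd_sum_of_forwarded:
  fixes a f :: "nat \<Rightarrow> int"
  assumes "k < K" "\<And>j. j < K \<Longrightarrow> z dvd f j - (\<Sum>i\<in>{..<K} - {j}. a i)"
    and "z dvd (\<Sum>i\<in>{..<K} - {k}. a i)"
  shows "z dvd (\<Sum>j\<in>{..<K} - {k}. f j) \<longleftrightarrow> z dvd (int K - 1) * a k"
proof -
  have "z dvd (\<Sum>j\<in>{..<K} - {k}. f j - (\<Sum>i\<in>{..<K} - {j}. a i))"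
    using assms(2) by (intro dvd_sum) auto
  then have "z dvd (\<Sum>j\<in>{..<K} - {k}. f j)
      - ((int K - 2) * (\<Sum>i\<in>{..<K} - {k}. a i) + (int K - 1) * a k)"
    by (simp add: sum_subtractf sum_sums_of_others[OF assms(1)])
  from dvd_add_right_iff[OF this, of "(int K - 2) * (\<Sum>i\<in>{..<K} - {k}. a i) + (int K - 1) * a k"]
  show ?thesis using assms(3) by (simp add: dvd_add_right_iff)
qed

text \<open>Levels of \<open>E\<close> are received free of interference in both slots. A level
  \<open>l + d\<close> with \<open>l \<in> E\<close> may belong to \<open>B\<close>: its
  interference comes from \<open>E\<close> and is known in each slot.\<close>

lemma achievable_weak_feedback:
  assumes s: "s \<ge> 2" and p: "real (card E) \<le> 2 * p" and n: "n = m + d"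
    and BE: "B \<subseteq> {1..n}" "E \<subseteq> {1..n}" "B \<inter> E = {}"
    and B: "\<forall>l\<in>B. l + d \<notin> B \<union> E" and E: "\<forall>l\<in>E. l + d \<le> n \<and> l + d \<notin> E"
    and rate: "2 * R \<le> real (2 * card B + card E) * log 2 (real s)"
  shows "achievable_sym_rate K s n m p R"
proof -
  let ?I = "{0, 1 :: nat} \<times> B \<union> {0} \<times> E"
  let ?E = "(\<lambda>l. l + d) ` E"
  have fin: "finite B" "finite E" using BE finite_subset by blast+
  have input: "feedback_input s B E d t u v \<in> signals s n" if "u \<in> ?I \<rightarrow>\<^sub>E {0..<int s}" for t u v
    using that by (rule feedback_input_signals) (use s BE in auto)
  have q: "max m n = n" using n by simp
  show ?thesis
  proof (rule achievable_by_first_slot_feedback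
      [of s ?I ?E 2 _ "\<lambda>k. feedback_input s B E d"])
    fix k t u v assume "u \<in> ?I \<rightarrow>\<^sub>E {0..<int s}"
    then show "feedback_input s B E d t u v \<in> signals s (max m n)"
      unfolding q by (rule input)
  next
    fix u u' :: "nat \<Rightarrow> nat \<times> nat \<Rightarrow> int" and Y Y' :: "nat \<Rightarrow> nat \<Rightarrow> signal" and k
    define X where "X = (\<lambda>(Y :: nat \<Rightarrow> nat \<Rightarrow> signal) u t j.
      feedback_input s B E d t (u j) (restrict (Y 0 j) ?E))"
    assume k: "k < K"
      and u: "\<And>j. u j \<in> ?I \<rightarrow>\<^sub>E {0..<int s}" and u': "\<And>j. u' j \<in> ?I \<rightarrow>\<^sub>E {0..<int s}"
      and Y: "\<And>t k. Y t k = channel_output K s n m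
        (\<lambda>j. feedback_input s B E d t (u j) (restrict (Y 0 j) ?E)) k"
      and Y': "\<And>t k. Y' t k = channel_output K s n m
        (\<lambda>j. feedback_input s B E d t (u' j) (restrict (Y' 0 j) ?E)) k"
      and eq: "\<And>t. t < 2 \<Longrightarrow> Y t k = Y' t k"
    have Y: "Y t k = channel_output K s n m (X Y u t) k" for t k unfolding X_def by (rule Y)
    have Y': "Y' t k = channel_output K s n m (X Y' u' t) k" for t k unfolding X_def by (rule Y')
    have X_eq: "X Z w t j = feedback_input s B E d t (w j) (restrict (Z 0 j) ?E)" for Z w t j
      by (simp add: X_def)
    define D where "D t j l = X Y u t j l - X Y' u' t j l" for t j l
    define V where "V t k l = (\<Sum>j\<in>{..<K} - {k}. D t j l)" for t k l
    have sig: "X Y u t j \<in> signals s n" "X Y' u' t j \<in> signals s n" for t j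
      unfolding X_def by (rule input[OF u], rule input[OF u'])
    have obs: "int s dvd D t k l + V t k (l - d)" if "t < 2" "l \<le> n" for t l
    proof -
      have "channel_output K s n m (X Y u t) k = channel_output K s n m (X Y' u' t) k"
        by (rule trans[OF trans[OF Y[symmetric] eq[OF that(1)]] Y'])
      from channel_output_eq_dvd[OF _ _ this, of l] show ?thesis
        using sig that(2) n by (simp add: D_def V_def)
    qed
    \<comment> \<open>Stated for arbitrary \<open>Z\<close> and \<open>w\<close> because both
      message tuples need it.\<close>
    have forwarded: "X Z w 1 j l mod int s = (\<Sum>i\<in>{..<K} - {j}. X Z w 0 i l) mod int s"
      if "l \<in> E" and Z: "\<And>t k. Z t k = channel_output K s n m (X Z w t) k"
        and w: "\<And>t j. X Z w t j \<in> signals s n" for Z w j l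
    proof -
      \<comment> \<open>As \<open>l + d \<notin> E\<close>, the own first input there is a symbol on
        \<open>B\<close> or 0; removing it from the feedback leaves the interferers' level
        \<open>l\<close>.\<close>
      have l: "l \<notin> B" "l + d \<in> ?E" "l + d \<le> n" "l + d \<notin> E" using BE(3) E that by auto
      have "X Z w 0 j (l + d) = (if l + d \<in> B then w j (0, l + d) else 0)"
        using l by (simp add: X_def feedback_input_def)
      then have "X Z w 1 j l = (Z 0 j (l + d) - X Z w 0 j (l + d)) mod int s"
        using l that(1) unfolding X_eq[of Z w 1] feedback_input_def by simp
      moreover have "Z 0 j (l + d)
          = (X Z w 0 j (l + d) + (\<Sum>i\<in>{..<K} - {j}. X Z w 0 i l)) mod int s"
        unfolding Z[of 0 j] using channel_output_level[of "X Z w 0" s m n "l + d" K j] w l(3) n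
        by (simp add: q)
      ultimately show ?thesis by (simp add: mod_simps)
    qed
    have fwd: "int s dvd D 1 j l - V 0 j l" if "l \<in> E" for j l
    proof -
      have "int s dvd (X Y u 1 j l - X Y' u' 1 j l)
          - ((\<Sum>i\<in>{..<K} - {j}. X Y u 0 i l) - (\<Sum>i\<in>{..<K} - {j}. X Y' u' 0 i l))"
        unfolding mod_eq_dvd_iff[symmetric]
        by (intro mod_diff_cong forwarded that Y Y' sig)
      then show ?thesis by (simp add: D_def V_def sum_subtractf)
    qed
    have zero: "D t j l = 0" if "l \<notin> B" "l \<notin> E" for t j l
      using that by (simp add: D_def X_def feedback_input_def)
    have pos: "l \<ge> 1" if "l \<in> B \<union> E" for l using BE that by auto
    have pred: "l - d \<notin> B" "l \<in> E \<Longrightarrow> l - d \<notin> E" if "l \<in> B \<union> E" for l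
    proof -
      have l: "l - d + d = l" if "l - d \<in> B \<union> E" using pos[OF that] by simp
      show "l - d \<notin> B" using B l that by (metis UnI1)
      show "l - d \<notin> E" if "l \<in> E" using E l that by (metis UnI2)
    qed
    have extra: "int s dvd D 0 k l" "int s dvd V 0 k l" "int s dvd V 1 k l" if l: "l \<in> E" for l
    proof -
      have "V t k (l - d) = 0" for t using pred[of l] l by (simp add: V_def zero)
      then have own: "int s dvd D t k l" if "t < 2" for t
        using obs[of t l] that l BE(2) by auto
      from own[of 0] show "int s dvd D 0 k l" by simp
      \<comment> \<open>The own second input on \<open>l\<close> is the forwarded sum, so receiving
        it reveals the interference of slot 0.\<close>
      moreover have "int s dvd D 1 k l - (D 1 k l - V 0 k l)"
        by (intro dvd_diff own fwd l) simp
      then show "int s dvd V 0 k l" by simp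
      ultimately show "int s dvd V 1 k l"
        using dvd_sum_of_forwarded[of k K "int s" "\<lambda>j. D 1 j l" "\<lambda>j. D 0 j l"] k fwd[OF l]
        by (simp add: V_def)
    qed
    have base: "int s dvd D t k l" if "l \<in> B" "t < 2" for t l
    proof -
      have "int s dvd V t k (l - d)"
      proof (cases "l - d \<in> E")
        case True
        moreover have "t = 0 \<or> t = 1" using that(2) by auto
        ultimately show ?thesis using extra by auto
      next
        case False
        then show ?thesis using pred[of l] that(1) by (simp add: V_def zero)
      qed
      moreover have "int s dvd D t k l + V t k (l - d)" using obs that BE(1) by auto
      ultimately show ?thesis by (simp add: dvd_add_left_iff)
    qed
    have "int s dvd D t k l" if tl: "(t, l) \<in> ?I" for t l
      using tl base extra(1) by auto
    then show "u k = u' k"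
      by (intro residues_eqI[OF u u']) (force simp: D_def X_def feedback_input_def)
  qed (use s p fin rate BE(3) in \<open>auto simp: card_two_slots[unfolded One_nat_def] card_image feedback_input_def\<close>)
qed

text \<open>At output levels \<open>l \<le> d\<close> no own signal arrives, hence the offset 0: the
  feedback on \<open>E\<close> is already the sum to forward. Symbols on \<open>B\<close> are
  received at \<open>l + d\<close>, where the interferers are silent.\<close>

lemma achievable_strong_feedback:
  assumes s: "prime s" "K \<le> s" "K \<ge> 2" and p: "real (card E) \<le> 2 * p" and m: "m = n + d"
    and BE: "B \<subseteq> {1..m}" "E \<subseteq> {1..m}" "B \<inter> E = {}"
    and B: "\<forall>l\<in>B. l + d \<le> m \<and> l + d \<notin> B \<union> E" and E: "\<forall>l\<in>E. l \<le> d"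
    and rate: "2 * R \<le> real (2 * card B + card E) * log 2 (real s)"
  shows "achievable_sym_rate K s n m p R"
proof -
  let ?I = "{0, 1 :: nat} \<times> B \<union> {0} \<times> E"
  have fin: "finite B" "finite E" using BE finite_subset by blast+
  have s2: "s \<ge> 2" using s by simp
  have input: "feedback_input s B E 0 t u v \<in> signals s m" if "u \<in> ?I \<rightarrow>\<^sub>E {0..<int s}" for t u v
    using that by (rule feedback_input_signals) (use s2 BE in auto)
  have q: "max m n = m" using m by simp
  show ?thesis
  proof (rule achievable_by_first_slot_feedback
      [of s ?I E 2 _ "\<lambda>k. feedback_input s B E 0"])
    fix k t u v assume "u \<in> ?I \<rightarrow>\<^sub>E {0..<int s}"
    then show "feedback_input s B E 0 t u v \<in> signals s (max m n)"
      unfolding q by (rule input)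
  next
    fix u u' :: "nat \<Rightarrow> nat \<times> nat \<Rightarrow> int" and Y Y' :: "nat \<Rightarrow> nat \<Rightarrow> signal" and k
    define X where "X = (\<lambda>(Y :: nat \<Rightarrow> nat \<Rightarrow> signal) u t j.
      feedback_input s B E 0 t (u j) (restrict (Y 0 j) E))"
    assume k: "k < K"
      and u: "\<And>j. u j \<in> ?I \<rightarrow>\<^sub>E {0..<int s}" and u': "\<And>j. u' j \<in> ?I \<rightarrow>\<^sub>E {0..<int s}"
      and Y: "\<And>t k. Y t k = channel_output K s n m
        (\<lambda>j. feedback_input s B E 0 t (u j) (restrict (Y 0 j) E)) k"
      and Y': "\<And>t k. Y' t k = channel_output K s n m
        (\<lambda>j. feedback_input s B E 0 t (u' j) (restrict (Y' 0 j) E)) k"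
      and eq: "\<And>t. t < 2 \<Longrightarrow> Y t k = Y' t k"
    have Y: "Y t k = channel_output K s n m (X Y u t) k" for t k unfolding X_def by (rule Y)
    have Y': "Y' t k = channel_output K s n m (X Y' u' t) k" for t k unfolding X_def by (rule Y')
    have X_eq: "X Z w t j = feedback_input s B E 0 t (w j) (restrict (Z 0 j) E)" for Z w t j
      by (simp add: X_def)
    define D where "D t j l = X Y u t j l - X Y' u' t j l" for t j l
    define V where "V t k l = (\<Sum>j\<in>{..<K} - {k}. D t j l)" for t k l
    have sig: "X Y u t j \<in> signals s m" "X Y' u' t j \<in> signals s m" for t j
      unfolding X_def by (rule input[OF u], rule input[OF u'])
    have obs: "int s dvd D t k (l - d) + V t k l" if "t < 2" "l \<le> m" for t l
    proof -
      have "channel_output K s n m (X Y u t) k = channel_output K s n m (X Y' u' t) k"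
        by (rule trans[OF trans[OF Y[symmetric] eq[OF that(1)]] Y'])
      from channel_output_eq_dvd[OF _ _ this, of l] show ?thesis
        using sig that(2) m by (simp add: D_def V_def)
    qed
    have X0: "X Z w t j 0 = 0" for Z w t j
      unfolding X_eq feedback_input_def using BE by auto
    have forwarded: "X Z w 1 j l mod int s = (\<Sum>i\<in>{..<K} - {j}. X Z w 0 i l) mod int s"
      if "l \<in> E" and Z: "\<And>t k. Z t k = channel_output K s n m (X Z w t) k"
        and w: "\<And>t j. X Z w t j \<in> signals s m" for Z w j l
    proof -
      have l: "l \<notin> B" "l \<le> m" "l \<le> d" using BE E that by auto
      then have "X Z w 1 j l = Z 0 j l mod int s"
        using that(1) unfolding X_eq[of Z w 1] feedback_input_def by simp
      moreover have "Z 0 j l = (\<Sum>i\<in>{..<K} - {j}. X Z w 0 i l) mod int s"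
        unfolding Z[of 0 j] using channel_output_level[of "X Z w 0" s m n l K j] w l m
        by (simp add: X0)
      ultimately show ?thesis by simp
    qed
    have fwd: "int s dvd D 1 j l - V 0 j l" if "l \<in> E" for j l
    proof -
      have "int s dvd (X Y u 1 j l - X Y' u' 1 j l)
          - ((\<Sum>i\<in>{..<K} - {j}. X Y u 0 i l) - (\<Sum>i\<in>{..<K} - {j}. X Y' u' 0 i l))"
        unfolding mod_eq_dvd_iff[symmetric]
        by (intro mod_diff_cong forwarded that Y Y' sig)
      then show ?thesis by (simp add: D_def V_def sum_subtractf)
    qed
    have zero: "D t j l = 0" if "l \<notin> B" "l \<notin> E" for t j l
      using that by (simp add: D_def X_def feedback_input_def)
    have extra: "int s dvd D 0 k l" if l: "l \<in> E" for l
    proof -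
      have "D t k (l - d) = 0" for t using E l by (simp add: D_def X0)
      then have V: "int s dvd V t k l" if "t < 2" for t
        using obs[of t l] that l BE(2) by auto
      have "int s dvd (int K - 1) * D 0 k l"
        using dvd_sum_of_forwarded[of k K "int s" "\<lambda>j. D 1 j l" "\<lambda>j. D 0 j l"] k fwd[OF l]
          V[of 0] V[of 1]
        by (simp add: V_def)
      \<comment> \<open>Here \<open>0 < K - 1 < s\<close>; as \<open>s\<close> is prime, the factor
        can be cancelled.\<close>
      moreover have "\<not> int s dvd int K - 1" using s by (auto dest: zdvd_imp_le)
      ultimately show ?thesis using s(1) by (simp add: prime_dvd_mult_iff)
    qed
    have base: "int s dvd D t k l" if "l \<in> B" "t < 2" for t l
    proof -
      have "V t k (l + d) = 0" using B that(1) by (simp add: V_def zero)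
      then show ?thesis using obs[of t "l + d"] B that by auto
    qed
    have "int s dvd D t k l" if tl: "(t, l) \<in> ?I" for t l
      using tl base extra by auto
    then show "u k = u' k"
      by (intro residues_eqI[OF u u']) (force simp: D_def X_def feedback_input_def)
  qed (use s2 p fin rate BE(3) in \<open>auto simp: card_two_slots[unfolded One_nat_def] feedback_input_def\<close>)
qed

section \<open>Time sharing at equal gains\<close>

lemma achievable_time_sharing:
  assumes s: "s \<ge> 2" and "K \<ge> 1" "p \<ge> 0"
    and rate: "real K * R \<le> real n * log 2 (real s)"
  shows "achievable_sym_rate K s n n p R"
proof -
  \<comment> \<open>Slots are counted from 0 like the users, and slot \<open>k\<close> belongs to
    user \<open>k\<close> alone.\<close>
  let ?x = "\<lambda>k t (u :: nat \<Rightarrow> int) (v :: signal) l. if t = k \<and> l \<in> {1..n} then u l else 0"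
  have input: "?x k t u v \<in> signals s (max n n)" if "u \<in> {1..n} \<rightarrow>\<^sub>E {0..<int s}" for k t u v
  proof -
    have "u l \<in> {0..<int s}" if "l \<in> {1..n}" for l
      using \<open>u \<in> {1..n} \<rightarrow>\<^sub>E {0..<int s}\<close> that by (rule PiE_mem)
    then show ?thesis using s by (simp add: signals_def)
  qed
  show ?thesis
  proof (rule achievable_by_first_slot_feedback[of s "{1..n}" "{}" K _ ?x])
    fix u u' :: "nat \<Rightarrow> nat \<Rightarrow> int" and Y Y' :: "nat \<Rightarrow> nat \<Rightarrow> signal" and k
    assume k: "k < K"
      and u: "\<And>j. u j \<in> {1..n} \<rightarrow>\<^sub>E {0..<int s}" and u': "\<And>j. u' j \<in> {1..n} \<rightarrow>\<^sub>E {0..<int s}"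
      and Y: "\<And>t k. Y t k = channel_output K s n n (\<lambda>j. ?x j t (u j) (restrict (Y 0 j) {})) k"
      and Y': "\<And>t k. Y' t k = channel_output K s n n (\<lambda>j. ?x j t (u' j) (restrict (Y' 0 j) {})) k"
      and eq: "\<And>t. t < K \<Longrightarrow> Y t k = Y' t k"
    have "channel_output K s n n (\<lambda>j. ?x j k (u j) (restrict (Y 0 j) {})) k
        = channel_output K s n n (\<lambda>j. ?x j k (u' j) (restrict (Y' 0 j) {})) k"
      using eq[OF k] Y Y' by metis
    from channel_output_eq_dvd[OF input[OF u] input[OF u'] this]
    have "int s dvd u k l - u' k l" if "l \<in> {1..n}" for l
      using that by fastforce
    then show "u k = u' k" by (rule residues_eqI[OF u u'])
  qed (use assms input in auto)
qed

section \<open>Choice of levels in each regime\<close>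

theorem theorem1:
  fixes K s n m :: nat and p Rsym :: real
  assumes "K \<ge> 2"
    and "prime s" and "s \<ge> K"
    and "p \<ge> 0" and "2 * p \<in> \<int>"
    and "Rsym / log 2 (real s) = normalized_sym_rate K n m p"
  shows "achievable_sym_rate K s n m p Rsym"
proof -
  note norm = normalized_sym_rate_def[of K n m p]
  have s: "s \<ge> 2" using assms(1,3) by simp
  then have log: "log 2 (real s) > 0" by simp
  then have R: "Rsym = normalized_sym_rate K n m p * log 2 (real s)"
    using assms(6) by (simp add: field_simps)
  \<comment> \<open>Two slots have capacity for exactly \<open>r0\<close> fed back levels.\<close>
  obtain r0 where r0: "2 * p = real r0"
  proof -
    from assms(5) obtain z where z: "2 * p = of_int z" by (rule Ints_cases)
    then have "2 * p = real (nat z)" using assms(4) by simp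
    then show ?thesis by (rule that)
  qed
  have rate: "c * Rsym \<le> real b * log 2 (real s)" if "c * normalized_sym_rate K n m p = real b" for b c
    unfolding R using that by (simp add: mult.assoc[symmetric])
  \<comment> \<open>The case \<open>m = n = 0\<close> falls under the first alternative.\<close>
  consider "3 * m \<le> 2 * n" | "2 * n < 3 * m" "m < n" | "m = n" "n > 0" | "n < m" "m \<le> 2 * n"
    | "2 * n < m" by linarith
  then show ?thesis
  proof cases
    case 1
    \<comment> \<open>Truncation gives \<open>a = 0\<close> for
      \<open>2 * m \<le> n\<close>.\<close>
    define a where "a = 2 * m - n"
    \<comment> \<open>The second bound ensures \<open>a + r \<le> n - m\<close> and
      \<open>a + r \<le> m\<close>, so that the shift by \<open>n - m\<close> takes \<open>E\<close>
      off itself and keeps it within the \<open>n\<close> levels.\<close>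
    define r where "r = min r0 (if 2 * m \<le> n then m else 2 * n - 3 * m)"
    let ?B = "{1..a} \<union> {m + 1..n}" and ?E = "{a + 1..a + r}"
    have a: "a \<le> m" "a + r \<le> n - m" "a + r \<le> m" using 1 by (auto simp: a_def r_def)
    have card: "card ?B = a + (n - m)" using a by (subst card_Un_disjoint) auto
    show ?thesis
    proof (rule achievable_weak_feedback[of s ?E p n m "n - m" ?B])
      show "2 * Rsym \<le> real (2 * card ?B + card ?E) * log 2 (real s)"
      proof (rule rate)
        have "r = min r0 m" "a = 0" if "2 * m \<le> n" using that by (auto simp: r_def a_def)
        moreover have "real r = min (2 * p) (2 * real n - 3 * real m)" "real a = 2 * real m - real n"
          if "\<not> 2 * m \<le> n"
          using that 1 by (auto simp: r_def a_def r0 of_nat_diff min_def)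
        ultimately show "2 * normalized_sym_rate K n m p = real (2 * card ?B + card ?E)"
          using 1 r0 unfolding card norm by (auto simp: of_nat_diff min_def)
      qed
      show "real (card ?E) \<le> 2 * p" unfolding r0 by (simp add: r_def)
    qed (use s a 1 in \<open>auto simp: a_def\<close>)
  next
    case 2
    obtain F G where FG: "F \<subseteq> {1..m}" "G \<subseteq> {1..m}" "F \<inter> G = {}"
      "\<forall>l\<in>F \<union> G. l + (n - m) \<le> m \<and> l + (n - m) \<notin> F" "\<forall>l\<in>G. l + (n - m) \<notin> G"
      and card: "2 * card F + card G = m"
    proof -
      have "2 * (n - m) \<le> m" "n - m \<ge> 1" using 2 by auto
      from ex_alternating_levels[OF this] show ?thesis using that by blast
    qed
    \<comment> \<open>The last \<open>n - m\<close> levels are not heard by the other receivers, so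
      they are used in both slots on top of the alternating pattern.\<close>
    let ?F = "F \<union> {m + 1..n}"
    have "finite F" using FG(1) finite_subset by blast
    then have "card ?F = card F + (n - m)"
      using FG(1) by (subst card_Un_disjoint) auto
    then have card': "2 * card ?F + card G = 2 * n - m" using card 2 by linarith
    show ?thesis
    proof (rule achievable_weak_alignment[of s p n m "n - m" ?F G])
      show "2 * Rsym \<le> real (2 * card ?F + card G) * log 2 (real s)"
        by (rule rate) (unfold card' norm, use 2 in \<open>auto simp: of_nat_diff\<close>)
      show "?F \<subseteq> {1..n}" "G \<subseteq> {1..n}" "?F \<inter> G = {}" using FG(1-3) 2 by (auto simp: subset_iff)
      show "\<forall>l\<in>?F \<union> G. l + (n - m) \<notin> ?F"
      proof
        fix l assume "l \<in> ?F \<union> G"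
        then consider "l \<in> F \<union> G" | "m < l" by auto
        then show "l + (n - m) \<notin> ?F"
        proof cases
          case 1
          then have "l + (n - m) \<le> m" "l + (n - m) \<notin> F" using FG(4) by auto
          then show ?thesis by simp
        next
          case 2
          then show ?thesis using FG(1) \<open>m < n\<close> by (auto simp: subset_iff)
        qed
      qed
      show "\<forall>l\<in>G. l + (n - m) \<le> n \<and> l + (n - m) \<notin> G"
        using FG(4,5) \<open>m < n\<close> by (meson UnI2 le_trans less_imp_le)
    qed (use s assms(4) 2 in auto)
  next
    case 3
    then show ?thesis
      using achievable_time_sharing[of s K p Rsym n] s assms(1,4) rate[of "real K" n] norm by simp
  next
    case 4
    obtain F G where FG: "F \<subseteq> {1..m}" "G \<subseteq> {1..m}" "F \<inter> G = {}"
      "\<forall>l\<in>F \<union> G. l + (m - n) \<le> m \<and> l + (m - n) \<notin> F" "\<forall>l\<in>G. l + (m - n) \<notin> G"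
      and card: "2 * card F + card G = m"
    proof -
      have "2 * (m - n) \<le> m" "m - n \<ge> 1" using 4 by auto
      from ex_alternating_levels[OF this] show ?thesis using that by blast
    qed
    show ?thesis
    proof (rule achievable_strong_alignment[OF s assms(4) _ FG])
      show "2 * Rsym \<le> real (2 * card F + card G) * log 2 (real s)"
        by (rule rate) (unfold card norm, use 4 in auto)
    qed (use 4 in auto)
  next
    case 5
    \<comment> \<open>Input levels beyond \<open>n\<close> do not reach the own receiver; this bound
      keeps \<open>n + r\<close> within the \<open>m - n\<close> output levels free of own
      signal.\<close>
    define r where "r = min r0 (m - 2 * n)"
    show ?thesis
    proof (rule achievable_strong_feedback[of s K "{n + 1..n + r}" p m n "m - n" "{1..n}"])
      have "real r = min (2 * p) (real m - 2 * real n)"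
        using 5 by (auto simp: r_def r0 of_nat_diff min_def)
      then show "2 * Rsym \<le> real (2 * card {1..n} + card {n + 1..n + r}) * log 2 (real s)"
        by (intro rate) (use 5 in \<open>auto simp: norm min_def\<close>)
      show "real (card {n + 1..n + r}) \<le> 2 * p" unfolding r0 by (simp add: r_def)
    qed (use assms 5 in \<open>auto simp: r_def\<close>)
  qed
qed

end
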